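(* Let $(x,u_1,\dots,u_\nu,y)$ be coordinates on $\mathbb{R}^{\nu+2}$. Let $f\in C^\infty(\mathbb{R}^\nu)$ and let $\Xi=(\Xi_{ab})$ be an invertible symmetric (constant, real) $\nu\times\nu$ matrix of signature $(r,s)$. Define a metric $g$ of signature $(r+1,s+1)$ on $\mathbb{R}^{\nu+2}$ whose (possibly) non-zero components are $$g(\partial_x,\partial_x)=-2f(\vec u),\quad g(\partial_x,\partial_y)=g(\partial_y,\partial_x)=1,\quad g(\partial_{u_a},\partial_{u_b})=\Xi_{ab},$$ where $\vec u=(u_1,\dots,u_\nu)$, all other components with respect to the coordinate frame being zero. Then $\mathcal{M}=(\mathbb{R}^{\nu+2},g)$ is skew Tsankov and $\mathcal{R}$ is nilpotent of order $3$.
   Context: For a pseudo-Riemannian manifold $\mathcal{M}=(M,g)$, let $R$ be the curvature tensor of the Levi-Civita connection and let $\mathcal{R}(x,y)$ be the skew-symmetric curvature operator, $g(\mathcal{R}(x,y)z,w)=R(x,y,z,w)$. $\mathcal{M}$ is skew Tsankov if for every $P\in M$, $\mathcal{R}(x_1,x_2)\mathcal{R}(x_3,x_4)=\mathcal{R}(x_3,x_4)\mathcal{R}(x_1,x_2)$ for all $x_1,x_2,x_3,x_4\in T_PM$. "$\mathcal{R}$ is nilpotent of order $k$" means that $\mathcal{R}(\xi_1,\xi_2)^k=0$ for every $P\in M$ and all $\xi_1,\xi_2\in T_PM$ (no claim is made that $k$ is minimal; e.g. the flat case $\mathcal{R}=0$ is included). *)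

theory Defs
  imports "HOL-Analysis.Analysis"
begin

section \<open>Smooth functions\<close>

primrec C_k :: "nat \<Rightarrow> ('a::euclidean_space \<Rightarrow> 'b::euclidean_space) \<Rightarrow> bool" where
  "C_k 0 h \<longleftrightarrow> continuous_on UNIV h"
| "C_k (Suc k) h \<longleftrightarrow>
     (\<forall>P. h differentiable (at P)) \<and> (\<forall>v. C_k k (\<lambda>P. frechet_derivative h (at P) v))"

definition smooth :: "('a::euclidean_space \<Rightarrow> 'b::euclidean_space) \<Rightarrow> bool" where
  "smooth h \<longleftrightarrow> (\<forall>k. C_k k h)"


section \<open>Symmetric bilinear forms and their signature\<close>

definition form :: "real^'m^'m \<Rightarrow> real^'m \<Rightarrow> real^'m \<Rightarrow> real" where
  "form A v w = v \<bullet> (A *v w)"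

text \<open>Signature \<open>(p, q)\<close> of a nondegenerate symmetric form: there is a pseudo-orthonormal
  basis with \<open>p\<close> vectors of square \<open>-1\<close> (timelike) and \<open>q\<close> vectors of square \<open>+1\<close>
  (spacelike). Linear independence of the \<open>e i\<close> is automatic, and \<open>p\<close>, \<open>q\<close> are unique by
  Sylvester's law of inertia.\<close>

definition has_signature :: "real^'m^'m \<Rightarrow> nat \<Rightarrow> nat \<Rightarrow> bool" where
  "has_signature A p q \<longleftrightarrow>
     (\<exists>e :: 'm \<Rightarrow> real^'m.
        (\<forall>i j. i \<noteq> j \<longrightarrow> form A (e i) (e j) = 0) \<and>
        (\<forall>i. form A (e i) (e i) = -1 \<or> form A (e i) (e i) = 1) \<and>
        card {i. form A (e i) (e i) = -1} = p \<and>
        card {i. form A (e i) (e i) = 1} = q)"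


section \<open>Pseudo-Riemannian metrics on \<open>\<real>\<^sup>m\<close>, the Levi-Civita connection and its curvature\<close>

text \<open>Every tangent space of \<open>\<real>\<^sup>m\<close> is identified with \<open>real^'m\<close>, the coordinate vector
  \<open>\<partial>\<^sub>i\<close> being \<open>axis i 1\<close>; a metric is the matrix field of its components in the
  coordinate frame, and a vector field is a function \<open>real^'m \<Rightarrow> real^'m\<close>.\<close>

definition pseudo_riemannian_metric :: "(real^'m \<Rightarrow> real^'m^'m) \<Rightarrow> nat \<Rightarrow> nat \<Rightarrow> bool" where
  "pseudo_riemannian_metric g p q \<longleftrightarrow>
     (\<forall>i j. smooth (\<lambda>P. g P $ i $ j)) \<and>
     (\<forall>P. transpose (g P) = g P \<and> invertible (g P) \<and> has_signature (g P) p q)"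

definition metric_deriv :: "(real^'m \<Rightarrow> real^'m^'m) \<Rightarrow> real^'m \<Rightarrow> 'm \<Rightarrow> 'm \<Rightarrow> 'm \<Rightarrow> real" where
  "metric_deriv g P i j k = frechet_derivative (\<lambda>Q. g Q $ j $ k) (at P) (axis i 1)"

text \<open>\<open>christoffel g P k i j\<close> is
  \<open>\<Gamma>\<^sup>k\<^sub>i\<^sub>j = 1/2 \<Sum>\<^sub>l g\<^sup>k\<^sup>l (\<partial>\<^sub>i g\<^sub>j\<^sub>l + \<partial>\<^sub>j g\<^sub>i\<^sub>l - \<partial>\<^sub>l g\<^sub>i\<^sub>j)\<close>.\<close>

definition christoffel :: "(real^'m \<Rightarrow> real^'m^'m) \<Rightarrow> real^'m \<Rightarrow> 'm \<Rightarrow> 'm \<Rightarrow> 'm \<Rightarrow> real" where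
  "christoffel g P k i j =
     (\<Sum>l\<in>UNIV. matrix_inv (g P) $ k $ l *
        (metric_deriv g P i j l + metric_deriv g P j i l - metric_deriv g P l i j)) / 2"

definition levi_civita ::
    "(real^'m \<Rightarrow> real^'m^'m) \<Rightarrow> (real^'m \<Rightarrow> real^'m) \<Rightarrow> (real^'m \<Rightarrow> real^'m) \<Rightarrow> real^'m \<Rightarrow> real^'m" where
  "levi_civita g X Y P =
     frechet_derivative Y (at P) (X P) +
     (\<chi> k. \<Sum>i\<in>UNIV. \<Sum>j\<in>UNIV. christoffel g P k i j * X P $ i * Y P $ j)"

definition lie_bracket ::
    "(real^'m \<Rightarrow> real^'m) \<Rightarrow> (real^'m \<Rightarrow> real^'m) \<Rightarrow> real^'m \<Rightarrow> real^'m" where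
  "lie_bracket X Y P = frechet_derivative Y (at P) (X P) - frechet_derivative X (at P) (Y P)"

text \<open>The properties that single out the Levi-Civita connection among all connections: it is
  torsion free, and the metric is parallel.\<close>

lemma levi_civita_torsion_free:
  assumes "\<And>Q. transpose (g Q) = g Q"
  shows "levi_civita g X Y P - levi_civita g Y X P = lie_bracket X Y P"
proof -
  have sym: "g Q $ i $ j = g Q $ j $ i" for Q i j
    using assms[of Q] by (metis transpose_def vec_lambda_beta)
  have "metric_deriv g P i j k = metric_deriv g P i k j" for i j k
    unfolding metric_deriv_def by (subst sym) simp
  then have chr: "christoffel g P k i j = christoffel g P k j i" for k i j
    unfolding christoffel_def by (simp add: add.commute)
  have "(\<Sum>i\<in>UNIV. \<Sum>j\<in>UNIV. christoffel g P k i j * X P $ i * Y P $ j) =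
        (\<Sum>i\<in>UNIV. \<Sum>j\<in>UNIV. christoffel g P k i j * Y P $ i * X P $ j)" for k
    by (subst sum.swap) (simp add: chr[of k] mult_ac)
  then show ?thesis
    unfolding levi_civita_def lie_bracket_def by simp
qed

lemma levi_civita_metric:
  assumes sym: "\<And>Q. transpose (g Q) = g Q" and inv: "invertible (g P)"
    and dg: "\<And>j k. (\<lambda>Q. g Q $ j $ k) differentiable (at P)"
    and dY: "Y differentiable (at P)" and dZ: "Z differentiable (at P)"
  shows "frechet_derivative (\<lambda>Q. form (g Q) (Y Q) (Z Q)) (at P) (X P) =
         form (g P) (levi_civita g X Y P) (Z P) + form (g P) (Y P) (levi_civita g X Z P)"
proof -
  define C where "C v w = (\<chi> k. \<Sum>i\<in>UNIV. \<Sum>j\<in>UNIV. christoffel g P k i j * v $ i * w $ j)" for v w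
  define d where "d = metric_deriv g P"
  define D where "D j k = frechet_derivative (\<lambda>Q. g Q $ j $ k) (at P)" for j k
  define DY where "DY = frechet_derivative Y (at P)"
  define DZ where "DZ = frechet_derivative Z (at P)"
  have symc: "g Q $ i $ j = g Q $ j $ i" for Q i j
    using sym[of Q] by (metis transpose_def vec_lambda_beta)
  have dsym: "d i j k = d i k j" for i j k
    unfolding d_def metric_deriv_def by (subst symc) simp
  have hY: "(Y has_derivative DY) (at P)" and hZ: "(Z has_derivative DZ) (at P)"
    using dY dZ frechet_derivative_works DY_def DZ_def by blast+
  have hg: "((\<lambda>Q. g Q $ j $ k) has_derivative D j k) (at P)" for j k
    using dg frechet_derivative_works D_def by metis
  have hYc: "((\<lambda>Q. Y Q $ j) has_derivative (\<lambda>v. DY v $ j)) (at P)" for j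
    by (rule bounded_linear.has_derivative[OF bounded_linear_vec_nth hY])
  have hZc: "((\<lambda>Q. Z Q $ j) has_derivative (\<lambda>v. DZ v $ j)) (at P)" for j
    by (rule bounded_linear.has_derivative[OF bounded_linear_vec_nth hZ])
  have form_eq: "form A v w = (\<Sum>j\<in>UNIV. \<Sum>k\<in>UNIV. v $ j * (A $ j $ k * w $ k))" for A :: "real^'a^'a" and v w
    unfolding form_def inner_vec_def matrix_vector_mult_def by (simp add: sum_distrib_left)
  have "((\<lambda>Q. form (g Q) (Y Q) (Z Q)) has_derivative
         (\<lambda>v. \<Sum>j\<in>UNIV. \<Sum>k\<in>UNIV. Y P $ j * (g P $ j $ k * DZ v $ k + D j k v * Z P $ k)
             + DY v $ j * (g P $ j $ k * Z P $ k))) (at P)"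
    unfolding form_eq by (intro has_derivative_sum has_derivative_mult hYc hZc hg)
  then have "frechet_derivative (\<lambda>Q. form (g Q) (Y Q) (Z Q)) (at P) =
      (\<lambda>v. \<Sum>j\<in>UNIV. \<Sum>k\<in>UNIV. Y P $ j * (g P $ j $ k * DZ v $ k + D j k v * Z P $ k)
             + DY v $ j * (g P $ j $ k * Z P $ k))"
    by (rule frechet_derivative_at[symmetric])
  then have L: "frechet_derivative (\<lambda>Q. form (g Q) (Y Q) (Z Q)) (at P) (X P) =
      form (g P) (Y P) (DZ (X P)) + form (g P) (DY (X P)) (Z P)
      + (\<Sum>j\<in>UNIV. \<Sum>k\<in>UNIV. Y P $ j * D j k (X P) * Z P $ k)"
    unfolding form_eq sum.distrib[symmetric] by (simp only: distrib_left add_ac mult_ac)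
  have Dx: "D j k v = (\<Sum>i\<in>UNIV. v $ i * d i j k)" for j k v
  proof -
    have lin: "linear (D j k)" using hg has_derivative_linear by blast
    have "D j k v = D j k (\<Sum>i\<in>UNIV. v $ i *\<^sub>R axis i 1)"
      using basis_expansion[of v] by (simp add: scalar_mult_eq_scaleR)
    also have "\<dots> = (\<Sum>i\<in>UNIV. v $ i * d i j k)"
      unfolding d_def metric_deriv_def D_def[symmetric]
      by (simp add: linear_sum[OF lin] linear_cmul[OF lin])
    finally show ?thesis .
  qed
  have invr: "g P ** matrix_inv (g P) = mat 1"
    using someI_ex[OF inv[unfolded invertible_def]] unfolding matrix_inv_def by (rule conjunct1)
  have low: "(g P *v C v w) $ m =
      (\<Sum>i\<in>UNIV. \<Sum>j\<in>UNIV. (d i j m + d j i m - d m i j) / 2 * (v $ i * w $ j))" for v w m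
  proof -
    define F where "F = (\<chi> l. \<Sum>i\<in>UNIV. \<Sum>j\<in>UNIV. (d i j l + d j i l - d l i j) / 2 * (v $ i * w $ j))"
    have "C v w = matrix_inv (g P) *v F"
    proof (rule vec_eq_iff[THEN iffD2], rule allI)
      fix k
      have "C v w $ k = (\<Sum>i\<in>UNIV. \<Sum>j\<in>UNIV. \<Sum>l\<in>UNIV. matrix_inv (g P) $ k $ l *
           ((d i j l + d j i l - d l i j) / 2 * (v $ i * w $ j)))"
        unfolding C_def christoffel_def d_def[symmetric]
        by (simp add: sum_divide_distrib sum_distrib_left mult_ac)
      also have "\<dots> = (\<Sum>i\<in>UNIV. \<Sum>l\<in>UNIV. \<Sum>j\<in>UNIV. matrix_inv (g P) $ k $ l *
           ((d i j l + d j i l - d l i j) / 2 * (v $ i * w $ j)))"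
        by (intro sum.cong refl sum.swap)
      also have "\<dots> = (\<Sum>l\<in>UNIV. \<Sum>i\<in>UNIV. \<Sum>j\<in>UNIV. matrix_inv (g P) $ k $ l *
           ((d i j l + d j i l - d l i j) / 2 * (v $ i * w $ j)))"
        by (rule sum.swap)
      also have "\<dots> = (matrix_inv (g P) *v F) $ k"
        unfolding F_def matrix_vector_mult_def by (simp only: vec_lambda_beta sum_distrib_left)
      finally show "C v w $ k = (matrix_inv (g P) *v F) $ k" .
    qed
    then have "g P *v C v w = F"
      by (simp add: matrix_vector_mul_assoc invr)
    then show ?thesis by (simp add: F_def)
  qed
  have fsym: "form (g P) v w = form (g P) w v" for v w
    unfolding form_def using sym[of P]
    by (metis dot_lmul_matrix inner_commute transpose_matrix_vector)
  have lin1: "form (g P) u (v + w) = form (g P) u v + form (g P) u w" for u v w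
    unfolding form_def by (simp add: matrix_vector_right_distrib inner_add_right)
  have lin2: "form (g P) (v + w) u = form (g P) v u + form (g P) w u" for u v w
    using fsym lin1 by metis
  have T: "form (g P) u (C v w) = (\<Sum>m\<in>UNIV. \<Sum>i\<in>UNIV. \<Sum>j\<in>UNIV.
       (d i j m + d j i m - d m i j) / 2 * (v $ i * w $ j * u $ m))" for u v w
    unfolding form_def inner_vec_def low by (simp add: sum_distrib_left mult_ac)
  have A: "form (g P) (Y P) (C (X P) (Z P)) = (\<Sum>m\<in>UNIV. \<Sum>i\<in>UNIV. \<Sum>j\<in>UNIV.
       (d i j m + d j i m - d m i j) / 2 * (X P $ i * Z P $ j * Y P $ m))"
    by (rule T)
  have B: "form (g P) (C (X P) (Y P)) (Z P) = (\<Sum>m\<in>UNIV. \<Sum>i\<in>UNIV. \<Sum>j\<in>UNIV.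
       (d i m j + d m i j - d j i m) / 2 * (X P $ i * Y P $ m * Z P $ j))"
  proof -
    have "form (g P) (C (X P) (Y P)) (Z P) = (\<Sum>j\<in>UNIV. \<Sum>i\<in>UNIV. \<Sum>m\<in>UNIV.
       (d i m j + d m i j - d j i m) / 2 * (X P $ i * Y P $ m * Z P $ j))"
      unfolding fsym[of "C _ _"] by (rule T)
    also have "\<dots> = (\<Sum>i\<in>UNIV. \<Sum>j\<in>UNIV. \<Sum>m\<in>UNIV.
       (d i m j + d m i j - d j i m) / 2 * (X P $ i * Y P $ m * Z P $ j))"
      by (rule sum.swap)
    also have "\<dots> = (\<Sum>i\<in>UNIV. \<Sum>m\<in>UNIV. \<Sum>j\<in>UNIV.
       (d i m j + d m i j - d j i m) / 2 * (X P $ i * Y P $ m * Z P $ j))"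
      by (intro sum.cong refl sum.swap)
    also have "\<dots> = (\<Sum>m\<in>UNIV. \<Sum>i\<in>UNIV. \<Sum>j\<in>UNIV.
       (d i m j + d m i j - d j i m) / 2 * (X P $ i * Y P $ m * Z P $ j))"
      by (rule sum.swap)
    finally show ?thesis .
  qed
  have "(\<Sum>j\<in>UNIV. \<Sum>k\<in>UNIV. Y P $ j * D j k (X P) * Z P $ k) =
      (\<Sum>m\<in>UNIV. \<Sum>j\<in>UNIV. \<Sum>i\<in>UNIV. d i m j * (X P $ i * Y P $ m * Z P $ j))"
    unfolding Dx by (simp add: sum_distrib_left sum_distrib_right mult_ac)
  also have "\<dots> = (\<Sum>m\<in>UNIV. \<Sum>i\<in>UNIV. \<Sum>j\<in>UNIV. d i m j * (X P $ i * Y P $ m * Z P $ j))"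
    by (intro sum.cong refl sum.swap)
  also have "\<dots> = form (g P) (Y P) (C (X P) (Z P)) + form (g P) (C (X P) (Y P)) (Z P)"
    unfolding A B sum.distrib[symmetric]
  proof (intro sum.cong refl)
    fix m i j
    show "d i m j * (X P $ i * Y P $ m * Z P $ j) =
      (d i j m + d j i m - d m i j) / 2 * (X P $ i * Z P $ j * Y P $ m) +
      (d i m j + d m i j - d j i m) / 2 * (X P $ i * Y P $ m * Z P $ j)"
      unfolding dsym[of i j m] by (simp add: field_simps)
  qed
  finally have M: "(\<Sum>j\<in>UNIV. \<Sum>k\<in>UNIV. Y P $ j * D j k (X P) * Z P $ k) =
      form (g P) (Y P) (C (X P) (Z P)) + form (g P) (C (X P) (Y P)) (Z P)" .
  have "levi_civita g X Y P = DY (X P) + C (X P) (Y P)"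
       "levi_civita g X Z P = DZ (X P) + C (X P) (Z P)"
    unfolding levi_civita_def DY_def DZ_def C_def by simp_all
  then show ?thesis
    using L M by (simp add: lin1 lin2)
qed

definition curvature ::
    "(real^'m \<Rightarrow> real^'m^'m) \<Rightarrow> (real^'m \<Rightarrow> real^'m) \<Rightarrow> (real^'m \<Rightarrow> real^'m) \<Rightarrow>
     (real^'m \<Rightarrow> real^'m) \<Rightarrow> real^'m \<Rightarrow> real^'m" where
  "curvature g X Y Z P =
     levi_civita g X (levi_civita g Y Z) P - levi_civita g Y (levi_civita g X Z) P
     - levi_civita g (lie_bracket X Y) Z P"

text \<open>The operator \<open>\<R>(x, y)\<close> on the tangent space at \<open>P\<close>. As curvature is tensorial, its value
  at \<open>P\<close> depends only on the values of the fields there, and each tangent vector is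
  extended to the field with constant coefficients in the coordinate frame.\<close>

definition curvature_operator ::
    "(real^'m \<Rightarrow> real^'m^'m) \<Rightarrow> real^'m \<Rightarrow> real^'m \<Rightarrow> real^'m \<Rightarrow> real^'m \<Rightarrow> real^'m" where
  "curvature_operator g P x y z = curvature g (\<lambda>_. x) (\<lambda>_. y) (\<lambda>_. z) P"

definition curvature_tensor ::
    "(real^'m \<Rightarrow> real^'m^'m) \<Rightarrow> real^'m \<Rightarrow> real^'m \<Rightarrow> real^'m \<Rightarrow> real^'m \<Rightarrow> real^'m \<Rightarrow> real" where
  "curvature_tensor g P x y z w = form (g P) (curvature_operator g P x y z) w"

definition skew_tsankov :: "(real^'m \<Rightarrow> real^'m^'m) \<Rightarrow> bool" where
  "skew_tsankov g \<longleftrightarrow>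
     (\<forall>P x1 x2 x3 x4.
        curvature_operator g P x1 x2 \<circ> curvature_operator g P x3 x4 =
        curvature_operator g P x3 x4 \<circ> curvature_operator g P x1 x2)"

definition curvature_nilpotent :: "(real^'m \<Rightarrow> real^'m^'m) \<Rightarrow> nat \<Rightarrow> bool" where
  "curvature_nilpotent g k \<longleftrightarrow> (\<forall>P x y. curvature_operator g P x y ^^ k = (\<lambda>_. 0))"


section \<open>The metric\<close>

text \<open>Index type of the coordinates \<open>(x, u\<^sub>1, \<dots>, u\<^sub>\<nu>, y)\<close>, where \<open>\<nu> = CARD('n)\<close>; it has
  \<open>\<nu> + 2\<close> elements, so that \<open>real^('n coord)\<close> is \<open>\<real>\<^sup>\<nu>\<^sup>+\<^sup>2\<close>.\<close>

datatype 'n coord = Cx | Cu 'n | Cy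

lemma UNIV_coord: "(UNIV :: 'n coord set) = {Cx, Cy} \<union> range Cu"
proof -
  have "z \<in> {Cx, Cy} \<union> range Cu" for z :: "'n coord"
    by (cases z) auto
  then show ?thesis by auto
qed

instance coord :: (finite) finite
  by standard (simp add: UNIV_coord)

lemma CARD_coord: "CARD('n::finite coord) = CARD('n) + 2"
proof -
  have "card (range (Cu :: 'n \<Rightarrow> 'n coord)) = CARD('n)"
    by (simp add: card_image inj_on_def)
  moreover have "{Cx, Cy} \<inter> range (Cu :: 'n \<Rightarrow> 'n coord) = {}" by auto
  ultimately show ?thesis
    by (simp add: UNIV_coord card_Un_disjoint)
qed

definition u_vec :: "real^('n coord) \<Rightarrow> real^'n" where
  "u_vec P = (\<chi> a. P $ Cu a)"

definition metric_of ::
    "(real^'n \<Rightarrow> real) \<Rightarrow> real^'n^'n \<Rightarrow> real^('n coord) \<Rightarrow> real^('n coord)^('n coord)" where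
  "metric_of f \<Xi> P = (\<chi> i j.
     case (i, j) of
       (Cx, Cx) \<Rightarrow> - 2 * f (u_vec P)
     | (Cx, Cy) \<Rightarrow> 1
     | (Cy, Cx) \<Rightarrow> 1
     | (Cu a, Cu b) \<Rightarrow> \<Xi> $ a $ b
     | _ \<Rightarrow> 0)"

end

theory Submission
  imports Defs
begin

text \<open>
  Write a tangent vector as \<open>z = (z\<^sub>x, z\<^sub>u, z\<^sub>y)\<close>. The metric depends on the point only through
  its component \<open>g\<^sub>x\<^sub>x = - 2 f(u)\<close>, so all Christoffel symbols are linear in \<open>\<eta> = grad f\<close>;
  the connection adds to the directional derivative the bilinear term
  \<open>\<Gamma>(v, w) = (0, v\<^sub>x w\<^sub>x \<Xi>\<^sup>-\<^sup>1 \<eta>, - v\<^sub>x (\<eta> \<bullet> w\<^sub>u) - w\<^sub>x (\<eta> \<bullet> v\<^sub>u))\<close>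
  (\<open>christoffel_vec\<close>, \<open>levi_civita_metric_of\<close>).

  This term is linear in \<open>\<eta>\<close>, so differentiating it once more just replaces \<open>\<eta>\<close> by its
  derivative \<open>H\<close>. The quadratic part of the curvature cancels: \<open>\<Gamma>(x, \<Gamma>(y, z))\<close> is a multiple of
  \<open>x\<^sub>x y\<^sub>x z\<^sub>x \<partial>\<^sub>y\<close> and hence symmetric in \<open>x\<close> and \<open>y\<close>. What is left has the form
  \<open>\<R>(x, y) z = (0, z\<^sub>x \<Xi>\<^sup>-\<^sup>1 \<omega>, c z\<^sub>x - \<omega> \<bullet> z\<^sub>u)\<close> with a covector \<open>\<omega>\<close> and a scalar \<open>c\<close> that
  depend on \<open>x\<close>, \<open>y\<close> and the point (\<open>curvature_operator_metric_of\<close>).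

  Such an operator shifts the flag \<open>0 \<subseteq> span \<partial>\<^sub>y \<subseteq> {z. z\<^sub>x = 0} \<subseteq> \<real>\<^sup>\<nu>\<^sup>+\<^sup>2\<close> down by one step, so its cube
  vanishes. The product of the operators given by \<open>\<omega>\<close> and \<open>\<omega>'\<close> sends \<open>z\<close> to
  \<open>- z\<^sub>x (\<omega> \<bullet> \<Xi>\<^sup>-\<^sup>1 \<omega>') \<partial>\<^sub>y\<close>, which is symmetric in \<open>\<omega>\<close> and \<open>\<omega>'\<close> because \<open>\<Xi>\<close> is symmetric; so any
  two of these operators commute.
\<close>


section \<open>Smoothness\<close>

lemma C_k_const: "C_k k (\<lambda>_. c)"
  by (induction k arbitrary: c) simp_all

text \<open>Precomposition with a linear map commutes with taking directional derivatives, except that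
  the direction \<open>v\<close> is replaced by \<open>l v\<close>, which does not depend on the point. The induction
  therefore reproduces a function of the same shape.\<close>

lemma C_k_compose_linear:
  fixes h :: "'a::euclidean_space \<Rightarrow> real" and l :: "'c::euclidean_space \<Rightarrow> 'a"
  assumes l: "linear l" and h: "C_k k h"
  shows "C_k k (\<lambda>P. c * h (l P))"
  using h
proof (induction k arbitrary: h)
  case 0
  moreover have "continuous_on UNIV l"
    using l linear_continuous_on linear_conv_bounded_linear by blast
  ultimately have "continuous_on UNIV (\<lambda>P. h (l P))"
    using continuous_on_compose2[of UNIV h UNIV l] by simp
  then show ?case by (simp add: continuous_on_mult_left)
next
  case (Suc k)
  have D: "((\<lambda>P. c * h (l P)) has_derivative
      (\<lambda>v. c * frechet_derivative h (at (l P)) (l v))) (at P)" for P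
  proof -
    have "(h has_derivative frechet_derivative h (at (l P))) (at (l P))"
      using Suc.prems frechet_derivative_works by auto
    from has_derivative_compose[OF linear_imp_has_derivative[OF l] this]
    show ?thesis by (rule has_derivative_mult_right)
  qed
  have "frechet_derivative (\<lambda>P. c * h (l P)) (at P) v
      = c * frechet_derivative h (at (l P)) (l v)" for P v
    using frechet_derivative_at[OF D] by metis
  moreover have "(\<lambda>P. c * h (l P)) differentiable (at P)" for P
    using D by (rule differentiableI)
  moreover have "C_k k (\<lambda>P. c * frechet_derivative h (at (l P)) (l v))" for v
    by (rule Suc.IH) (use Suc.prems in simp)
  ultimately show ?case by simp
qed


section \<open>The coordinates \<open>(x, u, y)\<close>\<close>

definition coord_vec :: "real \<Rightarrow> real^'n \<Rightarrow> real \<Rightarrow> real^('n coord)" where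
  "coord_vec a u b = (\<chi> i. case i of Cx \<Rightarrow> a | Cu k \<Rightarrow> u $ k | Cy \<Rightarrow> b)"

lemma coord_vec_nth [simp]:
  "coord_vec a u b $ Cx = a" "coord_vec a u b $ Cu k = u $ k" "coord_vec a u b $ Cy = b"
  by (simp_all add: coord_vec_def)

lemma u_vec_nth [simp]: "u_vec v $ k = v $ Cu k"
  by (simp add: u_vec_def)

lemma u_vec_coord_vec [simp]: "u_vec (coord_vec a u b) = u"
  by (simp add: vec_eq_iff)

lemma u_vec_zero [simp]: "u_vec 0 = 0"
  by (simp add: vec_eq_iff)

lemma linear_u_vec: "linear u_vec"
  by (rule linearI) (simp_all add: vec_eq_iff)

lemmas u_vec_simps [simp] =
  linear_add[OF linear_u_vec] linear_diff[OF linear_u_vec] linear_cmul[OF linear_u_vec]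

lemma coord_vec_eq_iff:
  "v = w \<longleftrightarrow> v $ Cx = w $ Cx \<and> u_vec v = u_vec w \<and> v $ Cy = w $ Cy"
  for v w :: "real^('n::finite coord)"
  unfolding vec_eq_iff u_vec_nth by (metis coord.exhaust)

lemma sum_coord:
  fixes F :: "'n::finite coord \<Rightarrow> real"
  shows "(\<Sum>i\<in>UNIV. F i) = F Cx + (\<Sum>a\<in>UNIV. F (Cu a)) + F Cy"
proof -
  have "(\<Sum>i\<in>range Cu. F i) = (\<Sum>a\<in>UNIV. F (Cu a))"
    by (subst sum.reindex) (auto simp: inj_on_def)
  moreover have "Cx \<notin> range (Cu :: 'n \<Rightarrow> 'n coord)" "Cy \<notin> range (Cu :: 'n \<Rightarrow> 'n coord)" by auto
  ultimately show ?thesis by (simp add: UNIV_coord add_ac)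
qed


section \<open>The metric\<close>

lemma metric_of_nth [simp]:
  "metric_of f \<Xi> P $ Cx $ Cx = - 2 * f (u_vec P)"
  "metric_of f \<Xi> P $ Cx $ Cu b = 0"
  "metric_of f \<Xi> P $ Cx $ Cy = 1"
  "metric_of f \<Xi> P $ Cu a $ Cx = 0"
  "metric_of f \<Xi> P $ Cu a $ Cu b = \<Xi> $ a $ b"
  "metric_of f \<Xi> P $ Cu a $ Cy = 0"
  "metric_of f \<Xi> P $ Cy $ Cx = 1"
  "metric_of f \<Xi> P $ Cy $ Cu b = 0"
  "metric_of f \<Xi> P $ Cy $ Cy = 0"
  by (simp_all add: metric_of_def)

lemma metric_of_mult_vec:
  "metric_of f \<Xi> P *v v =
     coord_vec (- 2 * f (u_vec P) * v $ Cx + v $ Cy) (\<Xi> *v u_vec v) (v $ Cx)"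
  unfolding coord_vec_eq_iff
  by (simp add: vec_eq_iff matrix_vector_mult_def sum_coord)

lemma form_metric_of:
  "form (metric_of f \<Xi> P) v w =
     - 2 * f (u_vec P) * v $ Cx * w $ Cx + v $ Cx * w $ Cy + v $ Cy * w $ Cx
     + form \<Xi> (u_vec v) (u_vec w)"
  unfolding form_def metric_of_mult_vec inner_vec_def[of v] inner_vec_def[of "u_vec v"]
  by (simp add: sum_coord algebra_simps)

lemma smooth_metric_of:
  assumes "smooth f"
  shows "smooth (\<lambda>P. metric_of f \<Xi> P $ i $ j)"
proof (cases "i = Cx \<and> j = Cx")
  case True
  then show ?thesis
    using assms C_k_compose_linear[OF linear_u_vec, of _ f "- 2"] by (simp add: smooth_def)
next
  case False
  then have "(\<lambda>P. metric_of f \<Xi> P $ i $ j) = (\<lambda>_. metric_of f \<Xi> 0 $ i $ j)"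
    by (cases i; cases j) simp_all
  then show ?thesis
    by (simp only: smooth_def C_k_const simp_thms)
qed

lemma transpose_metric_of:
  assumes "transpose \<Xi> = \<Xi>"
  shows "transpose (metric_of f \<Xi> P) = metric_of f \<Xi> P"
proof -
  have "transpose \<Xi> $ a $ b = \<Xi> $ b $ a" for a b
    by (simp add: transpose_def)
  then have "\<Xi> $ a $ b = \<Xi> $ b $ a" for a b
    unfolding assms .
  then have "metric_of f \<Xi> P $ i $ j = metric_of f \<Xi> P $ j $ i" for i j
    by (cases i; cases j) simp_all
  then show ?thesis by (simp add: vec_eq_iff transpose_def)
qed

lemma matrix_inv_mult_vec:
  fixes A :: "real^'m^'m"
  assumes "invertible A"
  shows "matrix_inv A *v v = w \<longleftrightarrow> v = A *v w"
proof -
  have "A ** matrix_inv A = mat 1" "matrix_inv A ** A = mat 1"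
    using someI_ex[OF assms[unfolded invertible_def]] unfolding matrix_inv_def by auto
  then show ?thesis
    by (metis matrix_vector_mul_assoc matrix_vector_mul_lid)
qed

text \<open>The plane of \<open>\<partial>\<^sub>x\<close> and \<open>\<partial>\<^sub>y\<close> is orthogonal to the \<open>u\<close> directions and nondegenerate, since
  \<open>\<partial>\<^sub>y\<close> is null and pairs to \<open>1\<close> with \<open>\<partial>\<^sub>x\<close>.\<close>

lemma invertible_metric_of:
  assumes "invertible \<Xi>"
  shows "invertible (metric_of f \<Xi> P)"
proof -
  have "v = 0" if "metric_of f \<Xi> P *v v = 0" for v
  proof -
    have "\<Xi> *v u_vec v = 0" "v $ Cx = 0" "v $ Cy = 0"
      using that unfolding metric_of_mult_vec coord_vec_eq_iff by auto
    moreover from this(1) have "u_vec v = 0"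
      using matrix_inv_mult_vec[OF assms] by (metis matrix_vector_mult_0_right)
    ultimately show ?thesis by (simp add: coord_vec_eq_iff)
  qed
  then show ?thesis
    by (simp add: invertible_left_inverse matrix_left_invertible_ker)
qed

text \<open>The plane of \<open>\<partial>\<^sub>x\<close> and \<open>\<partial>\<^sub>y\<close> is hyperbolic and contributes one vector of each sign: the
  square of \<open>\<partial>\<^sub>x + b \<partial>\<^sub>y\<close> is \<open>2 (b - f)\<close>, which equals \<open>-1\<close> and \<open>1\<close> for \<open>b = f - 1/2\<close> and
  \<open>b = f + 1/2\<close>, and these two vectors are orthogonal.\<close>

lemma has_signature_metric_of:
  fixes \<Xi> :: "real^'n^'n"
  assumes "has_signature \<Xi> r s"
  shows "has_signature (metric_of f \<Xi> P) (r + 1) (s + 1)"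
proof -
  obtain e :: "'n \<Rightarrow> real^'n" where orth: "\<And>i j. i \<noteq> j \<Longrightarrow> form \<Xi> (e i) (e j) = 0"
    and unit: "\<And>i. form \<Xi> (e i) (e i) = -1 \<or> form \<Xi> (e i) (e i) = 1"
    and neg: "card {i. form \<Xi> (e i) (e i) = -1} = r"
    and pos: "card {i. form \<Xi> (e i) (e i) = 1} = s"
    using assms unfolding has_signature_def by blast
  define E where "E i = (case i of Cx \<Rightarrow> coord_vec 1 0 (f (u_vec P) - 1/2)
      | Cu a \<Rightarrow> coord_vec 0 (e a) 0 | Cy \<Rightarrow> coord_vec 1 0 (f (u_vec P) + 1/2))" for i
  have form0: "form \<Xi> 0 v = 0" "form \<Xi> v 0 = 0" for v
    by (simp_all add: form_def)
  let ?g = "\<lambda>i j. form (metric_of f \<Xi> P) (E i) (E j)"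
  have g_Cu: "?g (Cu a) (Cu b) = form \<Xi> (e a) (e b)" for a b
    by (simp add: form_metric_of E_def)
  have g_Cx: "?g Cx Cx = -1" and g_Cy: "?g Cy Cy = 1"
    by (simp_all add: form_metric_of E_def form0)
  have "?g i j = 0" if "i \<noteq> j" for i j
    using that orth by (cases i; cases j) (auto simp: form_metric_of E_def form0)
  moreover have "?g i i = -1 \<or> ?g i i = 1" for i
    using unit g_Cu g_Cx g_Cy by (cases i) auto
  moreover have "card {i. ?g i i = -1} = r + 1"
  proof -
    have "{i. ?g i i = -1} = insert Cx (Cu ` {a. form \<Xi> (e a) (e a) = -1})" (is "?L = ?R")
    proof (rule set_eqI)
      show "i \<in> ?L \<longleftrightarrow> i \<in> ?R" for i by (cases i) (auto simp: g_Cu g_Cx g_Cy)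
    qed
    moreover have "card (Cu ` {a. form \<Xi> (e a) (e a) = -1}) = r"
      using neg by (simp add: card_image inj_on_def)
    ultimately show ?thesis by (simp add: card_insert_if image_iff)
  qed
  moreover have "card {i. ?g i i = 1} = s + 1"
  proof -
    have "{i. ?g i i = 1} = insert Cy (Cu ` {a. form \<Xi> (e a) (e a) = 1})" (is "?L = ?R")
    proof (rule set_eqI)
      show "i \<in> ?L \<longleftrightarrow> i \<in> ?R" for i by (cases i) (auto simp: g_Cu g_Cx g_Cy)
    qed
    moreover have "card (Cu ` {a. form \<Xi> (e a) (e a) = 1}) = s"
      using pos by (simp add: card_image inj_on_def)
    ultimately show ?thesis by (simp add: card_insert_if image_iff)
  qed
  ultimately show ?thesis unfolding has_signature_def by blast
qed


section \<open>The Levi-Civita connection\<close>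

definition grad :: "(real^'n \<Rightarrow> real) \<Rightarrow> real^'n \<Rightarrow> real^'n" where
  "grad f p = (\<chi> a. frechet_derivative f (at p) (axis a 1))"

text \<open>The term by which the connection at a point where \<open>f\<close> has gradient \<open>\<eta>\<close> differs from the flat
  one. Taking \<open>\<eta>\<close> as an argument, in place of the point, exposes the linear dependence on it.\<close>

definition christoffel_vec ::
    "real^'n^'n \<Rightarrow> real^'n \<Rightarrow> real^('n coord) \<Rightarrow> real^('n coord) \<Rightarrow> real^('n coord)" where
  "christoffel_vec \<Xi> \<eta> v w =
     coord_vec 0 ((v $ Cx * w $ Cx) *\<^sub>R (matrix_inv \<Xi> *v \<eta>))
       (- (v $ Cx * (\<eta> \<bullet> u_vec w) + w $ Cx * (\<eta> \<bullet> u_vec v)))"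

lemma linear_christoffel_vec: "linear (\<lambda>\<eta>. christoffel_vec \<Xi> \<eta> v w)"
  by (rule linearI)
    (simp_all add: coord_vec_eq_iff christoffel_vec_def matrix_vector_mult_scaleR algebra_simps)

lemma metric_deriv_metric_of:
  fixes f :: "real^'n \<Rightarrow> real"
  assumes f: "f differentiable (at (u_vec P))"
  shows "metric_deriv (metric_of f \<Xi>) P i j k =
    (case i of Cu a \<Rightarrow> if j = Cx \<and> k = Cx then - 2 * grad f (u_vec P) $ a else 0 | _ \<Rightarrow> 0)"
proof (cases "j = Cx \<and> k = Cx")
  case True
  let ?f' = "frechet_derivative f (at (u_vec P))"
  have f': "(f has_derivative ?f') (at (u_vec P))"
    using f frechet_derivative_works by blast
  have "((\<lambda>Q. - 2 * f (u_vec Q)) has_derivative (\<lambda>v. - 2 * ?f' (u_vec v))) (at P)"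
    by (rule has_derivative_mult_right[OF
        has_derivative_compose[OF linear_imp_has_derivative[OF linear_u_vec] f']])
  then have "metric_deriv (metric_of f \<Xi>) P i j k = - 2 * ?f' (u_vec (axis i 1))"
    unfolding metric_deriv_def using True by (simp add: frechet_derivative_at[symmetric])
  moreover have "u_vec (axis (Cu a) 1) = axis a 1"
      "u_vec (axis Cx 1 :: real^('n coord)) = 0" "u_vec (axis Cy 1 :: real^('n coord)) = 0"
    for a :: 'n
    by (auto simp: vec_eq_iff axis_def)
  moreover have "?f' 0 = 0"
    using f' has_derivative_linear linear_0 by blast
  ultimately show ?thesis
    using True by (cases i) (simp_all add: grad_def)
next
  case False
  then have "(\<lambda>Q. metric_of f \<Xi> Q $ j $ k) = (\<lambda>_. metric_of f \<Xi> 0 $ j $ k)"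
    by (cases j; cases k) simp_all
  then have "metric_deriv (metric_of f \<Xi>) P i j k = 0"
    unfolding metric_deriv_def by (simp only: frechet_derivative_const)
  then show ?thesis using False by (cases i) auto
qed

text \<open>Pulling the inverse metric out of the Christoffel symbols leaves those of the first kind; the
  connection can then be found by solving a linear system for the metric itself.\<close>

lemma levi_civita_eq_matrix_inv:
  fixes g :: "real^'m \<Rightarrow> real^'m^'m"
  shows "levi_civita g X Y P = frechet_derivative Y (at P) (X P) +
    matrix_inv (g P) *v (\<chi> l. \<Sum>i\<in>UNIV. \<Sum>j\<in>UNIV.
      (metric_deriv g P i j l + metric_deriv g P j i l - metric_deriv g P l i j) / 2
        * (X P $ i * Y P $ j))"
proof -
  define c where "c l i j = (metric_deriv g P i j l + metric_deriv g P j i l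
    - metric_deriv g P l i j) / 2 * (X P $ i * Y P $ j)" for l i j
  have "(\<Sum>i\<in>UNIV. \<Sum>j\<in>UNIV. christoffel g P k i j * X P $ i * Y P $ j) =
      (\<Sum>l\<in>UNIV. matrix_inv (g P) $ k $ l * (\<Sum>i\<in>UNIV. \<Sum>j\<in>UNIV. c l i j))" for k
  proof -
    have "(\<Sum>i\<in>UNIV. \<Sum>j\<in>UNIV. christoffel g P k i j * X P $ i * Y P $ j) =
        (\<Sum>i\<in>UNIV. \<Sum>j\<in>UNIV. \<Sum>l\<in>UNIV. matrix_inv (g P) $ k $ l * c l i j)"
      unfolding christoffel_def c_def
      by (simp add: sum_divide_distrib sum_distrib_left sum_distrib_right mult_ac)
    also have "\<dots> = (\<Sum>i\<in>UNIV. \<Sum>l\<in>UNIV. \<Sum>j\<in>UNIV. matrix_inv (g P) $ k $ l * c l i j)"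
      by (intro sum.cong refl sum.swap)
    also have "\<dots> = (\<Sum>l\<in>UNIV. \<Sum>i\<in>UNIV. \<Sum>j\<in>UNIV. matrix_inv (g P) $ k $ l * c l i j)"
      by (rule sum.swap)
    finally show ?thesis by (simp add: sum_distrib_left)
  qed
  then show ?thesis
    unfolding levi_civita_def c_def[symmetric] by (simp add: vec_eq_iff matrix_vector_mult_def)
qed

text \<open>\<open>christoffel_vec\<close> solves that system: only the \<open>u\<close>-derivatives of \<open>g\<^sub>x\<^sub>x\<close> enter the symbols of
  the first kind.\<close>

lemma levi_civita_metric_of:
  assumes inv: "invertible \<Xi>" and f: "\<And>p. f differentiable (at p)"
  shows "levi_civita (metric_of f \<Xi>) X Y P =
    frechet_derivative Y (at P) (X P) + christoffel_vec \<Xi> (grad f (u_vec P)) (X P) (Y P)"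
proof -
  let ?g = "metric_of f \<Xi>"
  define \<eta> where "\<eta> = grad f (u_vec P)"
  define F where "F = (\<chi> l. \<Sum>i\<in>UNIV. \<Sum>j\<in>UNIV.
      (metric_deriv ?g P i j l + metric_deriv ?g P j i l - metric_deriv ?g P l i j) / 2
        * (X P $ i * Y P $ j))"
  have "F = coord_vec (- (X P $ Cx * (\<eta> \<bullet> u_vec (Y P)) + Y P $ Cx * (\<eta> \<bullet> u_vec (X P))))
      ((X P $ Cx * Y P $ Cx) *\<^sub>R \<eta>) 0"
    unfolding coord_vec_eq_iff
    by (simp add: F_def vec_eq_iff sum_coord metric_deriv_metric_of[OF f] \<eta>_def[symmetric]
        inner_vec_def sum_distrib_left sum_negf mult_ac)
  moreover have "\<eta> = \<Xi> *v (matrix_inv \<Xi> *v \<eta>)"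
    using matrix_inv_mult_vec[OF inv] by metis
  ultimately have "F = ?g P *v christoffel_vec \<Xi> \<eta> (X P) (Y P)"
    by (simp add: metric_of_mult_vec christoffel_vec_def matrix_vector_mult_scaleR)
  then have "matrix_inv (?g P) *v F = christoffel_vec \<Xi> \<eta> (X P) (Y P)"
    using matrix_inv_mult_vec[OF invertible_metric_of[OF inv]] by blast
  then show ?thesis
    unfolding levi_civita_eq_matrix_inv F_def \<eta>_def by simp
qed


section \<open>The curvature\<close>

text \<open>For \<open>c = 0\<close> this is the infinitesimal null rotation about \<open>\<partial>\<^sub>y\<close> determined by \<open>\<omega>\<close>. The extra
  term is a multiple of \<open>dx \<otimes> \<partial>\<^sub>y\<close>; in the curvature operators, \<open>c\<close> collects the antisymmetric
  part of the second derivative of \<open>f\<close>.\<close>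

definition null_rotation ::
    "real^'n^'n \<Rightarrow> real^'n \<Rightarrow> real \<Rightarrow> real^('n coord) \<Rightarrow> real^('n coord)" where
  "null_rotation \<Xi> \<omega> c z =
     coord_vec 0 (z $ Cx *\<^sub>R (matrix_inv \<Xi> *v \<omega>)) (c * z $ Cx - \<omega> \<bullet> u_vec z)"

text \<open>The outer operator sees only the \<open>u\<close>-component of the inner value, whose \<open>x\<close>-component is \<open>0\<close>;
  both scalars \<open>c\<close> and \<open>c'\<close> are lost.\<close>

lemma null_rotation_comp:
  "null_rotation \<Xi> \<omega> c (null_rotation \<Xi> \<omega>' c' z) =
     coord_vec 0 0 (- (z $ Cx * (\<omega> \<bullet> (matrix_inv \<Xi> *v \<omega>'))))"
  by (simp add: null_rotation_def)

lemma null_rotation_commute: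
  assumes sym: "transpose \<Xi> = \<Xi>" and inv: "invertible \<Xi>"
  shows "null_rotation \<Xi> \<omega> c \<circ> null_rotation \<Xi> \<omega>' c' =
    null_rotation \<Xi> \<omega>' c' \<circ> null_rotation \<Xi> \<omega> c"
proof -
  let ?J = "matrix_inv \<Xi>"
  have self_adjoint: "(\<Xi> *v a) \<bullet> b = a \<bullet> (\<Xi> *v b)" for a b
    using sym by (metis dot_lmul_matrix transpose_matrix_vector)
  have "\<Xi> *v (?J *v v) = v" for v
    using matrix_inv_mult_vec[OF inv] by metis
  then have "\<omega> \<bullet> (?J *v \<omega>') = \<omega>' \<bullet> (?J *v \<omega>)"
    using self_adjoint[of "?J *v \<omega>" "?J *v \<omega>'"] by (simp add: inner_commute)
  then show ?thesis by (simp add: fun_eq_iff null_rotation_comp)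
qed

lemma null_rotation_cube: "null_rotation \<Xi> \<omega> c ^^ 3 = (\<lambda>_. 0)"
  by (rule ext)
    (simp add: numeral_3_eq_3 null_rotation_comp, simp add: null_rotation_def coord_vec_eq_iff)

lemma grad_differentiable:
  assumes "smooth f"
  shows "grad f differentiable (at p)"
proof -
  have "C_k 2 f" using assms by (simp add: smooth_def)
  then have "(\<lambda>p. frechet_derivative f (at p) v) differentiable (at p)" for v
    by (simp add: numeral_2_eq_2)
  then have "(\<lambda>p. grad f p \<bullet> b) differentiable (at p)" if "b \<in> Basis" for b
    using that by (auto simp: Basis_vec_def grad_def inner_axis)
  then show ?thesis
    using differentiable_componentwise_within by blast
qed

text \<open>On constant fields the connection reduces to \<open>christoffel_vec\<close>. Since this is linear in the
  gradient, its derivative along \<open>t\<close> is the same expression at \<open>H t\<close>, where \<open>H\<close> is the derivative of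
  \<open>grad f\<close> in the \<open>u\<close> directions. The covector is \<open>\<omega> = y\<^sub>x H x - x\<^sub>x H y\<close>.\<close>

lemma curvature_operator_metric_of:
  fixes f :: "real^'n \<Rightarrow> real"
  assumes f: "smooth f" and inv: "invertible \<Xi>"
  obtains \<omega> c where "curvature_operator (metric_of f \<Xi>) P x y = null_rotation \<Xi> \<omega> c"
proof -
  let ?\<Gamma> = "\<lambda>Q. christoffel_vec \<Xi> (grad f (u_vec Q))"
  define H where "H v = frechet_derivative (grad f) (at (u_vec P)) (u_vec v)" for v
  have "C_k 1 f" using f by (simp add: smooth_def)
  then have df: "f differentiable (at p)" for p by simp
  have "(grad f has_derivative frechet_derivative (grad f) (at (u_vec P))) (at (u_vec P))"
    using grad_differentiable[OF f] frechet_derivative_works by blast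
  from has_derivative_compose[OF linear_imp_has_derivative[OF linear_u_vec] this]
  have "((\<lambda>Q. grad f (u_vec Q)) has_derivative H) (at P)"
    unfolding H_def .
  then have "((\<lambda>Q. ?\<Gamma> Q v w) has_derivative (\<lambda>t. christoffel_vec \<Xi> (H t) v w)) (at P)" for v w
    by (rule bounded_linear.has_derivative[OF
        linear_conv_bounded_linear[THEN iffD1, OF linear_christoffel_vec]])
  then have d\<Gamma>: "frechet_derivative (\<lambda>Q. ?\<Gamma> Q v w) (at P) t = christoffel_vec \<Xi> (H t) v w" for v w t
    by (metis frechet_derivative_at)
  have connection: "levi_civita (metric_of f \<Xi>) (\<lambda>_. v) (\<lambda>_. w) = (\<lambda>Q. ?\<Gamma> Q v w)" for v w
    by (rule ext) (simp add: levi_civita_metric_of[OF inv df])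
  have bracket: "lie_bracket (\<lambda>_. x) (\<lambda>_. y) = (\<lambda>_. 0)"
    by (rule ext) (simp add: lie_bracket_def)
  have \<Gamma>0: "?\<Gamma> P 0 z = 0" for z
    by (simp add: christoffel_vec_def coord_vec_eq_iff)
  define \<omega> where "\<omega> = y $ Cx *\<^sub>R H x - x $ Cx *\<^sub>R H y"
  define c where "c = H y \<bullet> u_vec x - H x \<bullet> u_vec y"
  have "curvature_operator (metric_of f \<Xi>) P x y z =
      christoffel_vec \<Xi> (H x) y z + ?\<Gamma> P x (?\<Gamma> P y z)
      - (christoffel_vec \<Xi> (H y) x z + ?\<Gamma> P y (?\<Gamma> P x z))" for z
    unfolding curvature_operator_def curvature_def bracket connection
    by (simp add: levi_civita_metric_of[OF inv df] d\<Gamma> \<Gamma>0)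
  \<comment> \<open>Both sides are the same multiple of \<open>x\<^sub>x y\<^sub>x z\<^sub>x \<partial>\<^sub>y\<close>.\<close>
  moreover have "?\<Gamma> P x (?\<Gamma> P y z) = ?\<Gamma> P y (?\<Gamma> P x z)" for z
    by (simp add: christoffel_vec_def coord_vec_eq_iff)
  moreover have "christoffel_vec \<Xi> (H x) y z - christoffel_vec \<Xi> (H y) x z = null_rotation \<Xi> \<omega> c z" for z
    by (simp add: coord_vec_eq_iff christoffel_vec_def null_rotation_def \<omega>_def c_def
        matrix_vector_mult_scaleR algebra_simps)
  ultimately have "curvature_operator (metric_of f \<Xi>) P x y = null_rotation \<Xi> \<omega> c"
    by (simp add: fun_eq_iff)
  then show thesis by (rule that)
qed

theorem theorem6p1:
  fixes f :: "real^'n \<Rightarrow> real" and \<Xi> :: "real^'n^'n" and r s :: nat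
  assumes "smooth f"
    and "transpose \<Xi> = \<Xi>" and "invertible \<Xi>" and "has_signature \<Xi> r s"
  shows "pseudo_riemannian_metric (metric_of f \<Xi>) (r + 1) (s + 1) \<and>
         skew_tsankov (metric_of f \<Xi>) \<and>
         curvature_nilpotent (metric_of f \<Xi>) 3"
proof (intro conjI)
  show "pseudo_riemannian_metric (metric_of f \<Xi>) (r + 1) (s + 1)"
    unfolding pseudo_riemannian_metric_def
    using assms smooth_metric_of transpose_metric_of invertible_metric_of has_signature_metric_of
    by blast
  show "skew_tsankov (metric_of f \<Xi>)"
    unfolding skew_tsankov_def
    by (metis curvature_operator_metric_of null_rotation_commute assms(1-3))
  show "curvature_nilpotent (metric_of f \<Xi>) 3"
    unfolding curvature_nilpotent_def
    by (metis curvature_operator_metric_of null_rotation_cube assms(1,3))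
qed

end
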